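(* For every $n$ with $0<n<\omega$, there are continuum-many ($2^{\aleph_0}$) normal monomodal logics $L$ with $KU_{n+1}\subseteq L\subseteq KU_n$.
   Context: Monomodal formulas are built from countably many atoms $q_0,q_1,\dots$ using $\top,\neg,\vee,\Diamond$, with $\Box\varphi=\neg\Diamond\neg\varphi$. A normal modal logic is a set of formulas containing all propositional tautologies, $\Box(p\to q)\to(\Box p\to\Box q)$ and $\Diamond p\leftrightarrow\neg\Box\neg p$, closed under modus ponens, generalisation and uniform substitution. For $0<n<\omega$, $KU_n$ is the smallest normal modal logic containing $$U_n=\bigvee_{i\le n}\Box\bigl(\Box q_i\to\bigvee_{j\le n,\,j\ne i}\Box q_j\bigr).$$ *)

theory Defs
  imports Main "HOL-Library.Equipollence"
begin

datatype fm = Atom nat | Top | Neg fm | Or fm fm | Dia fm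

definition Bot :: fm where "Bot = Neg Top"
definition And :: "fm \<Rightarrow> fm \<Rightarrow> fm" where "And \<phi> \<psi> = Neg (Or (Neg \<phi>) (Neg \<psi>))"
definition Imp :: "fm \<Rightarrow> fm \<Rightarrow> fm" where "Imp \<phi> \<psi> = Or (Neg \<phi>) \<psi>"
definition Iff :: "fm \<Rightarrow> fm \<Rightarrow> fm" where "Iff \<phi> \<psi> = And (Imp \<phi> \<psi>) (Imp \<psi> \<phi>)"
definition Box :: "fm \<Rightarrow> fm" where "Box \<phi> = Neg (Dia (Neg \<phi>))"

fun Disj :: "fm list \<Rightarrow> fm" where
  "Disj [] = Bot"
| "Disj [\<phi>] = \<phi>"
| "Disj (\<phi> # \<psi> # \<phi>s) = Or \<phi> (Disj (\<psi> # \<phi>s))"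

primrec subst :: "(nat \<Rightarrow> fm) \<Rightarrow> fm \<Rightarrow> fm" where
  "subst \<sigma> (Atom i) = \<sigma> i"
| "subst \<sigma> Top = Top"
| "subst \<sigma> (Neg \<phi>) = Neg (subst \<sigma> \<phi>)"
| "subst \<sigma> (Or \<phi> \<psi>) = Or (subst \<sigma> \<phi>) (subst \<sigma> \<psi>)"
| "subst \<sigma> (Dia \<phi>) = Dia (subst \<sigma> \<phi>)"

(* Boolean evaluation in which atoms and formulas of the form Dia \<phi> are both
   treated as propositional variables, with truth values given by v. *)
primrec beval :: "(fm \<Rightarrow> bool) \<Rightarrow> fm \<Rightarrow> bool" where
  "beval v (Atom i) = v (Atom i)"
| "beval v Top = True"
| "beval v (Neg \<phi>) = (\<not> beval v \<phi>)"
| "beval v (Or \<phi> \<psi>) = (beval v \<phi> \<or> beval v \<psi>)"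
| "beval v (Dia \<phi>) = v (Dia \<phi>)"

definition tautology :: "fm \<Rightarrow> bool" where
  "tautology \<phi> \<longleftrightarrow> (\<forall>v. beval v \<phi>)"

(* The axioms are stated for the particular atoms p = Atom 0 and q = Atom 1;
   closure under substitution yields all other instances. *)
definition normal_logic :: "fm set \<Rightarrow> bool" where
  "normal_logic L \<longleftrightarrow>
     (\<forall>\<phi>. tautology \<phi> \<longrightarrow> \<phi> \<in> L) \<and>
     Imp (Box (Imp (Atom 0) (Atom 1))) (Imp (Box (Atom 0)) (Box (Atom 1))) \<in> L \<and>
     Iff (Dia (Atom 0)) (Neg (Box (Neg (Atom 0)))) \<in> L \<and>
     (\<forall>\<phi> \<psi>. \<phi> \<in> L \<longrightarrow> Imp \<phi> \<psi> \<in> L \<longrightarrow> \<psi> \<in> L) \<and>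
     (\<forall>\<phi>. \<phi> \<in> L \<longrightarrow> Box \<phi> \<in> L) \<and>
     (\<forall>\<phi> \<sigma>. \<phi> \<in> L \<longrightarrow> subst \<sigma> \<phi> \<in> L)"

definition U :: "nat \<Rightarrow> fm" where
  "U n = Disj (map (\<lambda>i. Box (Imp (Box (Atom i))
                 (Disj (map (\<lambda>j. Box (Atom j)) (filter (\<lambda>j. j \<noteq> i) [0..<Suc n])))))
               [0..<Suc n])"

definition KU :: "nat \<Rightarrow> fm set" where
  "KU n = \<Inter> {L. normal_logic L \<and> U n \<in> L}"

lemma KU_least:
  shows "normal_logic (KU n)" and "U n \<in> KU n"
    and "normal_logic L \<Longrightarrow> U n \<in> L \<Longrightarrow> KU n \<subseteq> L"
  unfolding KU_def normal_logic_def by blast+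

end

theory Submission
  imports Defs "HOL-Library.Countable"
begin

text \<open>
  A Kripke frame validates \<open>U n\<close> at a world \<open>w\<close> exactly if the successor sets \<open>R[y]\<close> of
  the successors \<open>y\<close> of \<open>w\<close> contain no inclusion-antichain of size \<open>n + 1\<close>
  (lemma \<open>U_correspondence\<close>). So \<open>KU n\<close> bounds a local width by \<open>n\<close>, while saying nothing about
  depth, and depth can be used to code an arbitrary set of natural numbers.

  For each \<open>k\<close> there is a frame, the spider, in which a root starts \<open>n + 1\<close> disjoint finite
  legs, and the longest leg has length \<open>k + 2\<close>. The root has exactly \<open>n + 1\<close> successors, with
  pairwise incomparable successor sets, so it refutes \<open>U n\<close> but the frame still validates
  \<open>U (n + 1)\<close>; every other world has at most one successor and validates \<open>U n\<close>.
  The depth of the root is expressed by a variable-free formula. Hence the implication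
  \<open>depth_fm n k\<close>, ``if the depth is exactly \<open>k + 2\<close>, then \<open>U n\<close>'', is refuted in the \<open>k\<close>-th
  spider and valid in all the others; and it belongs to \<open>KU n\<close>, being a weakening of \<open>U n\<close>.

  For a set \<open>S\<close> of natural numbers, let \<open>coded_logic n S\<close> consist of the theorems of \<open>KU n\<close> that
  are valid in the \<open>k\<close>-th spider for all \<open>k\<close> outside \<open>S\<close>. It is a normal logic in the interval,
  and it contains \<open>depth_fm n k\<close> iff \<open>k \<in> S\<close>. This gives continuum-many logics; there are no more
  because there are only countably many formulas.
\<close>

section \<open>Derivations in normal logics\<close>

lemma beval_Imp [simp]: "beval v (Imp \<phi> \<psi>) \<longleftrightarrow> (beval v \<phi> \<longrightarrow> beval v \<psi>)"
  by (simp add: Imp_def)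

lemma beval_Disj [simp]: "beval v (Disj \<phi>s) \<longleftrightarrow> (\<exists>\<phi>\<in>set \<phi>s. beval v \<phi>)"
  by (induction \<phi>s rule: Disj.induct) (auto simp: Bot_def)

context
  fixes L :: "fm set"
  assumes L: "normal_logic L"
begin

lemma tautology_in_logic: "tautology \<phi> \<Longrightarrow> \<phi> \<in> L"
  using L by (simp add: normal_logic_def)

lemma logic_mp: "\<phi> \<in> L \<Longrightarrow> Imp \<phi> \<psi> \<in> L \<Longrightarrow> \<psi> \<in> L"
  using L unfolding normal_logic_def by blast

lemma logic_taut_mp: "\<phi> \<in> L \<Longrightarrow> tautology (Imp \<phi> \<psi>) \<Longrightarrow> \<psi> \<in> L"
  using logic_mp tautology_in_logic by blast

lemma logic_taut_mp2: "\<phi> \<in> L \<Longrightarrow> \<psi> \<in> L \<Longrightarrow> tautology (Imp \<phi> (Imp \<psi> \<chi>)) \<Longrightarrow> \<chi> \<in> L"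
  using logic_mp logic_taut_mp by blast

lemma logic_Box_mono:
  assumes "Imp \<phi> \<psi> \<in> L"
  shows "Imp (Box \<phi>) (Box \<psi>) \<in> L"
proof -
  let ?\<sigma> = "\<lambda>i. if i = 0 then \<phi> else \<psi>"
  have "subst ?\<sigma> (Imp (Box (Imp (Atom 0) (Atom 1))) (Imp (Box (Atom 0)) (Box (Atom 1)))) \<in> L"
    using L unfolding normal_logic_def by blast
  then have K: "Imp (Box (Imp \<phi> \<psi>)) (Imp (Box \<phi>) (Box \<psi>)) \<in> L"
    by (simp add: Imp_def Box_def)
  have "Box (Imp \<phi> \<psi>) \<in> L"
    using L assms unfolding normal_logic_def by blast
  then show ?thesis
    using K logic_mp by blast
qed

lemma logic_Disj_mono:
  assumes "\<And>\<phi>. \<phi> \<in> set \<phi>s \<Longrightarrow> \<exists>\<psi>\<in>set \<psi>s. Imp \<phi> \<psi> \<in> L"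
  shows "Imp (Disj \<phi>s) (Disj \<psi>s) \<in> L"
proof -
  have weaken: "Imp \<phi> (Disj \<psi>s) \<in> L" if \<phi>: "\<phi> \<in> set \<phi>s" for \<phi>
  proof -
    obtain \<psi> where "\<psi> \<in> set \<psi>s" "Imp \<phi> \<psi> \<in> L"
      using assms[OF \<phi>] by blast
    moreover from this have "tautology (Imp (Imp \<phi> \<psi>) (Imp \<phi> (Disj \<psi>s)))"
      by (auto simp: tautology_def)
    ultimately show ?thesis
      using logic_taut_mp by blast
  qed
  have "Imp (Disj \<phi>s) \<chi> \<in> L" if "\<forall>\<phi>\<in>set \<phi>s. Imp \<phi> \<chi> \<in> L" for \<chi>
    using that
  proof (induction \<phi>s)
    case Nil
    show ?case
      by (rule tautology_in_logic) (simp add: tautology_def Bot_def)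
  next
    case (Cons \<phi> \<phi>s)
    then have "Imp \<phi> \<chi> \<in> L" "Imp (Disj \<phi>s) \<chi> \<in> L"
      by simp_all
    then show ?case
      by (rule logic_taut_mp2) (auto simp: tautology_def)
  qed
  then show ?thesis
    using weaken by blast
qed

text \<open>
  The \<open>i\<close>-th disjunct of \<open>U n\<close> implies the \<open>i\<close>-th disjunct of \<open>U (n + 1)\<close>, whose inner disjunction
  has one more member: a family without antichains of size \<open>n + 1\<close> has none of size \<open>n + 2\<close>.
\<close>
lemma U_in_logic_Suc:
  assumes "U n \<in> L"
  shows "U (Suc n) \<in> L"
proof -
  let ?B = "\<lambda>n i. Imp (Box (Atom i))
      (Disj (map (\<lambda>j. Box (Atom j)) (filter (\<lambda>j. j \<noteq> i) [0..<Suc n])))"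
  have "Imp (Box (?B n i)) (Box (?B (Suc n) i)) \<in> L" for i
    by (intro logic_Box_mono tautology_in_logic) (auto simp: tautology_def)
  then have "\<exists>\<psi>\<in>set (map (\<lambda>i. Box (?B (Suc n) i)) [0..<Suc (Suc n)]). Imp \<phi> \<psi> \<in> L"
    if \<phi>: "\<phi> \<in> set (map (\<lambda>i. Box (?B n i)) [0..<Suc n])" for \<phi>
  proof -
    from \<phi> obtain i where i: "i \<in> {0..<Suc n}" "\<phi> = Box (?B n i)"
      unfolding set_map set_upt by blast
    show ?thesis
    proof (rule bexI)
      show "Imp \<phi> (Box (?B (Suc n) i)) \<in> L"
        unfolding i(2) by fact
      have "i \<in> {0..<Suc (Suc n)}"
        using i(1) by simp
      then show "Box (?B (Suc n) i) \<in> set (map (\<lambda>i. Box (?B (Suc n) i)) [0..<Suc (Suc n)])"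
        unfolding set_map set_upt by (rule imageI)
    qed
  qed
  then have "Imp (U n) (U (Suc n)) \<in> L"
    unfolding U_def by (intro logic_Disj_mono)
  then show ?thesis
    using assms logic_mp by blast
qed

end

lemma KU_Suc_subset: "KU (Suc n) \<subseteq> KU n"
  by (intro KU_least(3) U_in_logic_Suc KU_least(1,2))

section \<open>Kripke semantics\<close>

primrec sat :: "('w \<Rightarrow> 'w \<Rightarrow> bool) \<Rightarrow> (nat \<Rightarrow> 'w \<Rightarrow> bool) \<Rightarrow> 'w \<Rightarrow> fm \<Rightarrow> bool" where
  "sat R V w (Atom i) = V i w"
| "sat R V w Top = True"
| "sat R V w (Neg \<phi>) = (\<not> sat R V w \<phi>)"
| "sat R V w (Or \<phi> \<psi>) = (sat R V w \<phi> \<or> sat R V w \<psi>)"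
| "sat R V w (Dia \<phi>) = (\<exists>u. R w u \<and> sat R V u \<phi>)"

lemma sat_simps [simp]:
  "sat R V w (And \<phi> \<psi>) \<longleftrightarrow> sat R V w \<phi> \<and> sat R V w \<psi>"
  "sat R V w (Imp \<phi> \<psi>) \<longleftrightarrow> (sat R V w \<phi> \<longrightarrow> sat R V w \<psi>)"
  "sat R V w (Iff \<phi> \<psi>) \<longleftrightarrow> (sat R V w \<phi> \<longleftrightarrow> sat R V w \<psi>)"
  "sat R V w (Box \<phi>) \<longleftrightarrow> (\<forall>u. R w u \<longrightarrow> sat R V u \<phi>)"
  by (auto simp: And_def Imp_def Iff_def Box_def)

lemma sat_Disj [simp]: "sat R V w (Disj \<phi>s) \<longleftrightarrow> (\<exists>\<phi>\<in>set \<phi>s. sat R V w \<phi>)"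
  by (induction \<phi>s rule: Disj.induct) (auto simp: Bot_def)

lemma beval_sat: "beval (sat R V w) \<phi> \<longleftrightarrow> sat R V w \<phi>"
  by (induction \<phi>) auto

lemma sat_subst: "sat R V w (subst \<sigma> \<phi>) \<longleftrightarrow> sat R (\<lambda>i u. sat R V u (\<sigma> i)) w \<phi>"
  by (induction \<phi> arbitrary: w) auto

definition frame_logic :: "('w \<Rightarrow> 'w \<Rightarrow> bool) \<Rightarrow> fm set" where
  "frame_logic R = {\<phi>. \<forall>V w. sat R V w \<phi>}"

lemma normal_frame_logic: "normal_logic (frame_logic R)"
proof -
  have "sat R V w \<phi>" if "tautology \<phi>" for V w \<phi>
    using that by (simp add: tautology_def flip: beval_sat)
  then show ?thesis
    by (auto simp: normal_logic_def frame_logic_def sat_subst)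
qed

lemma normal_logic_Inter:
  assumes "\<And>L. L \<in> \<L> \<Longrightarrow> normal_logic L"
  shows "normal_logic (\<Inter>\<L>)"
  using assms unfolding normal_logic_def by blast

lemma sat_U:
  "sat R V w (U n) \<longleftrightarrow> (\<exists>i\<le>n. \<forall>y. R w y \<and> (\<forall>z. R y z \<longrightarrow> V i z) \<longrightarrow>
      (\<exists>j\<le>n. j \<noteq> i \<and> (\<forall>z. R y z \<longrightarrow> V j z)))"
  unfolding U_def sat_Disj set_map set_filter set_upt bex_simps sat_simps sat.simps
  by (simp add: Bex_def less_Suc_eq_le) blast

text \<open>
  To refute \<open>U n\<close> from an antichain \<open>R[y 0], ..., R[y n]\<close>, interpret the \<open>i\<close>-th atom as \<open>R[y i]\<close>:
  then \<open>\<box>q\<^sub>i\<close> holds at \<open>y j\<close> iff \<open>R[y j] \<subseteq> R[y i]\<close>. Conversely, a refutation supplies for each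
  \<open>i\<close> a successor at which \<open>\<box>q\<^sub>i\<close> is the only true one among the boxed atoms, and any inclusion
  between the successor sets would transfer a boxed atom.
\<close>
lemma U_correspondence:
  "(\<forall>V. sat R V w (U n)) \<longleftrightarrow>
     \<not> (\<exists>y. (\<forall>i\<le>n. R w (y i)) \<and>
          (\<forall>i\<le>n. \<forall>j\<le>n. i \<noteq> j \<longrightarrow> \<not> Collect (R (y i)) \<subseteq> Collect (R (y j))))"
  (is "?valid \<longleftrightarrow> \<not> ?antichain")
proof
  show "\<not> ?antichain" if ?valid
  proof
    assume ?antichain
    then obtain y where y: "\<And>i. i \<le> n \<Longrightarrow> R w (y i)"
      "\<And>i j. i \<le> n \<Longrightarrow> j \<le> n \<Longrightarrow> i \<noteq> j \<Longrightarrow> \<not> Collect (R (y i)) \<subseteq> Collect (R (y j))"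
      by blast
    from \<open>?valid\<close> have "sat R (\<lambda>i. R (y i)) w (U n)" ..
    then obtain i where i: "i \<le> n"
      "\<And>u. R w u \<Longrightarrow> \<forall>z. R u z \<longrightarrow> R (y i) z \<Longrightarrow> \<exists>j\<le>n. j \<noteq> i \<and> (\<forall>z. R u z \<longrightarrow> R (y j) z)"
      unfolding sat_U by blast
    from i(2)[of "y i"] y i(1) obtain j where "j \<le> n" "j \<noteq> i" "\<forall>z. R (y i) z \<longrightarrow> R (y j) z"
      by blast
    with y(2)[of i j] i(1) show False
      by blast
  qed
  show ?valid if "\<not> ?antichain"
  proof (rule ccontr)
    assume "\<not> ?valid"
    then obtain V where "\<not> sat R V w (U n)"
      by blast
    then have "\<exists>u. R w u \<and> (\<forall>z. R u z \<longrightarrow> V i z) \<and>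
        (\<forall>j\<le>n. j \<noteq> i \<longrightarrow> \<not> (\<forall>z. R u z \<longrightarrow> V j z))" if "i \<le> n" for i
      using that unfolding sat_U by blast
    then have "\<forall>i\<in>{..n}. \<exists>u. R w u \<and> (\<forall>z. R u z \<longrightarrow> V i z) \<and>
        (\<forall>j\<le>n. j \<noteq> i \<longrightarrow> \<not> (\<forall>z. R u z \<longrightarrow> V j z))"
      by simp
    from bchoice[OF this] obtain y where
      "\<forall>i\<in>{..n}. R w (y i) \<and> (\<forall>z. R (y i) z \<longrightarrow> V i z) \<and>
        (\<forall>j\<le>n. j \<noteq> i \<longrightarrow> \<not> (\<forall>z. R (y i) z \<longrightarrow> V j z))" ..
    then have y: "\<forall>i\<le>n. R w (y i)"
      "\<And>i z. i \<le> n \<Longrightarrow> R (y i) z \<Longrightarrow> V i z"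
      "\<And>i j. i \<le> n \<Longrightarrow> j \<le> n \<Longrightarrow> j \<noteq> i \<Longrightarrow> \<not> (\<forall>z. R (y i) z \<longrightarrow> V j z)"
      by auto
    have "\<not> Collect (R (y i)) \<subseteq> Collect (R (y j))" if "i \<le> n" "j \<le> n" "i \<noteq> j" for i j
      using y(2)[of j] y(3)[of i j] that by auto
    with y(1) \<open>\<not> ?antichain\<close> show False
      by blast
  qed
qed

text \<open>Pigeonhole: among \<open>n + 1\<close> successors two coincide, so they cannot form an antichain.\<close>
lemma sat_U_if_few_successors:
  assumes "finite (Collect (R w))" "card (Collect (R w)) \<le> n"
  shows "sat R V w (U n)"
proof -
  have "\<not> (\<forall>i\<le>n. \<forall>j\<le>n. i \<noteq> j \<longrightarrow> \<not> Collect (R (y i)) \<subseteq> Collect (R (y j)))"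
    if y: "\<forall>i\<le>n. R w (y i)" for y
  proof -
    have "\<not> inj_on y {..n}"
    proof
      assume "inj_on y {..n}"
      then have "card {..n} \<le> card (Collect (R w))"
        using y assms(1) by (intro card_inj_on_le[of y]) auto
      then show False
        using assms(2) by simp
    qed
    then obtain i j where "i \<le> n" "j \<le> n" "i \<noteq> j" "y i = y j"
      unfolding inj_on_def by blast
    then show ?thesis
      by (metis order_refl)
  qed
  then show ?thesis
    using U_correspondence[of R w n] by blast
qed

section \<open>Spiders\<close>

text \<open>
  World \<open>(i, d)\<close> with \<open>i \<le> n\<close> and \<open>d > 0\<close> is the one at distance \<open>d\<close> from the root on leg \<open>i\<close>.
  Leg \<open>0\<close> has length \<open>k + 2\<close>; the others have length 2, just enough to give the first
  worlds of the legs incomparable successor sets. All \<open>(i, 0)\<close> are copies of one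
  root, and the remaining pairs are isolated dead ends.
\<close>
definition spider :: "nat \<Rightarrow> nat \<Rightarrow> nat \<times> nat \<Rightarrow> nat \<times> nat \<Rightarrow> bool" where
  "spider n k = (\<lambda>(i, d) (i', d').
     d' = Suc d \<and> (d = 0 \<or> i' = i) \<and> i' \<le> n \<and> d' \<le> (if i' = 0 then k + 2 else 2))"

lemma spider_leg_successors: "d > 0 \<Longrightarrow> Collect (spider n k (i, d)) \<subseteq> {(i, Suc d)}"
  by (auto simp: spider_def)

lemma spider_sat_U_off_root:
  assumes "0 < n" "d > 0"
  shows "sat (spider n k) V (i, d) (U n)"
proof (rule sat_U_if_few_successors)
  show "finite (Collect (spider n k (i, d)))"
    using spider_leg_successors[OF assms(2)] by (rule finite_subset) simp
  have "card (Collect (spider n k (i, d))) \<le> card {(i, Suc d)}"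
    using spider_leg_successors[OF assms(2)] by (intro card_mono) auto
  then show "card (Collect (spider n k (i, d))) \<le> n"
    using assms(1) by simp
qed

lemma spider_validates_U_Suc: "U (Suc n) \<in> frame_logic (spider n k)"
proof -
  have "sat (spider n k) V (i, d) (U (Suc n))" for V i d
  proof (rule sat_U_if_few_successors)
    have "Collect (spider n k (i, d)) \<subseteq> (\<lambda>j. (j, Suc d)) ` {..n}"
      by (auto simp: spider_def)
    then show "finite (Collect (spider n k (i, d)))" "card (Collect (spider n k (i, d))) \<le> Suc n"
      using surj_card_le[of "{..n}" "Collect (spider n k (i, d))" "\<lambda>j. (j, Suc d)"]
      by (auto intro: finite_subset)
  qed
  then show ?thesis
    by (auto simp: frame_logic_def)
qed

lemma spider_root_refutes_U: "\<exists>V. \<not> sat (spider n k) V (0, 0) (U n)"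
proof -
  have "Collect (spider n k (i, 1)) = {(i, 2)}" if "i \<le> n" for i
    using that by (auto simp: spider_def)
  then have "\<forall>i\<le>n. \<forall>j\<le>n. i \<noteq> j \<longrightarrow>
      \<not> Collect (spider n k (i, 1)) \<subseteq> Collect (spider n k (j, 1))"
    by simp
  moreover have "\<forall>i\<le>n. spider n k (0, 0) (i, 1)"
    by (simp add: spider_def)
  ultimately have "\<not> (\<forall>V. sat (spider n k) V (0, 0) (U n))"
    unfolding U_correspondence not_not by (intro exI[of _ "\<lambda>i. (i, 1)"] conjI)
  then show ?thesis
    by blast
qed

lemma spider_long_leg_depth:
  "d + m \<le> k + 2 \<Longrightarrow> sat (spider n k) V (0, d) ((Dia ^^ m) Top)"
proof (induction m arbitrary: d)
  case (Suc m)
  then have "sat (spider n k) V (0, Suc d) ((Dia ^^ m) Top)"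
    by simp
  moreover have "spider n k (0, d) (0, Suc d)"
    using Suc.prems by (simp add: spider_def)
  ultimately show ?case
    by auto
qed simp

lemma spider_depth_le:
  "sat (spider n k) V (i, d) ((Dia ^^ m) Top) \<Longrightarrow> m = 0 \<or> d + m \<le> k + 2"
proof (induction m arbitrary: i d)
  case (Suc m)
  then obtain i' where step: "spider n k (i, d) (i', Suc d)"
    and sat: "sat (spider n k) V (i', Suc d) ((Dia ^^ m) Top)"
    by (auto simp: spider_def)
  from step have "Suc d \<le> k + 2"
    by (simp add: spider_def split: if_splits)
  with Suc.IH[OF sat] show ?case
    by auto
qed simp

text \<open>So \<open>\<Diamond>\<^sup>m\<top>\<close> reads off the length of the longest leg, under every valuation.\<close>
lemma spider_root_depth: "sat (spider n k) V (i, 0) ((Dia ^^ m) Top) \<longleftrightarrow> m \<le> k + 2"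
proof
  show "sat (spider n k) V (i, 0) ((Dia ^^ m) Top) \<Longrightarrow> m \<le> k + 2"
    using spider_depth_le by fastforce
next
  assume "m \<le> k + 2"
  then have "sat (spider n k) V (0, 0) ((Dia ^^ m) Top)"
    by (simp add: spider_long_leg_depth)
  moreover have "spider n k (i, 0) = spider n k (0, 0)"
    by (auto simp: spider_def)
  ultimately show "sat (spider n k) V (i, 0) ((Dia ^^ m) Top)"
    by (cases m) auto
qed

section \<open>Coding sets of natural numbers by logics\<close>

definition depth_fm :: "nat \<Rightarrow> nat \<Rightarrow> fm" where
  "depth_fm n k = Imp (And ((Dia ^^ (k + 2)) Top) (Neg ((Dia ^^ (k + 3)) Top))) (U n)"

lemma depth_fm_in_KU: "depth_fm n k \<in> KU n"
  by (rule logic_taut_mp[OF KU_least(1,2)]) (simp add: depth_fm_def tautology_def)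

lemma spider_validates_depth_fm_iff:
  assumes "0 < n"
  shows "depth_fm n m \<in> frame_logic (spider n k) \<longleftrightarrow> m \<noteq> k"
proof
  assume valid: "depth_fm n m \<in> frame_logic (spider n k)"
  obtain V where "\<not> sat (spider n k) V (0, 0) (U n)"
    using spider_root_refutes_U by blast
  moreover have "sat (spider n k) V (0, 0) (depth_fm n m)"
    using valid unfolding frame_logic_def by blast
  ultimately show "m \<noteq> k"
    unfolding depth_fm_def sat_simps sat.simps spider_root_depth by auto
next
  assume "m \<noteq> k"
  have "sat (spider n k) V (i, d) (depth_fm n m)" for V i d
  proof (cases "d = 0")
    case True
    with \<open>m \<noteq> k\<close> show ?thesis
      unfolding depth_fm_def sat_simps sat.simps True spider_root_depth by auto
  next
    case False
    with assms show ?thesis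
      by (simp add: depth_fm_def spider_sat_U_off_root)
  qed
  then show "depth_fm n m \<in> frame_logic (spider n k)"
    by (auto simp: frame_logic_def)
qed

definition coded_logic :: "nat \<Rightarrow> nat set \<Rightarrow> fm set" where
  "coded_logic n S = \<Inter> (insert (KU n) ((\<lambda>k. frame_logic (spider n k)) ` (- S)))"

lemma normal_coded_logic: "normal_logic (coded_logic n S)"
  unfolding coded_logic_def
  by (rule normal_logic_Inter) (auto simp: KU_least(1) normal_frame_logic)

lemma coded_logic_bounds: "KU (Suc n) \<subseteq> coded_logic n S" "coded_logic n S \<subseteq> KU n"
proof -
  have "KU (Suc n) \<subseteq> frame_logic (spider n k)" for k
    by (intro KU_least(3) normal_frame_logic spider_validates_U_Suc)
  then show "KU (Suc n) \<subseteq> coded_logic n S"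
    using KU_Suc_subset unfolding coded_logic_def by blast
  show "coded_logic n S \<subseteq> KU n"
    unfolding coded_logic_def by blast
qed

lemma depth_fm_in_coded_logic_iff:
  assumes "0 < n"
  shows "depth_fm n m \<in> coded_logic n S \<longleftrightarrow> m \<in> S"
  by (auto simp: coded_logic_def depth_fm_in_KU spider_validates_depth_fm_iff[OF assms])

lemma inj_coded_logic: "0 < n \<Longrightarrow> inj (coded_logic n)"
  using depth_fm_in_coded_logic_iff by (intro injI set_eqI) metis

instance fm :: countable
  by countable_datatype

theorem mainTheorem7:
  fixes n :: nat
  assumes "0 < n"
  shows "{L. normal_logic L \<and> KU (n + 1) \<subseteq> L \<and> L \<subseteq> KU n} \<approx> (UNIV :: nat set set)"
proof (rule lepoll_antisym)
  let ?\<L> = "{L. normal_logic L \<and> KU (n + 1) \<subseteq> L \<and> L \<subseteq> KU n}"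
  have "inj_on ((`) (to_nat :: fm \<Rightarrow> nat)) ?\<L>"
    by (meson inj_image_eq_iff inj_onI inj_to_nat)
  then show "?\<L> \<lesssim> (UNIV :: nat set set)"
    unfolding lepoll_def by blast
  have "range (coded_logic n) \<subseteq> ?\<L>"
    using normal_coded_logic[of n] coded_logic_bounds[of n] by (simp add: image_subset_iff)
  then show "(UNIV :: nat set set) \<lesssim> ?\<L>"
    using inj_coded_logic[OF assms] unfolding lepoll_def by blast
qed

end
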